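(* Let $G$ be a connected $P_5$-free chordal bipartite graph of order $2n$. Then $G$ is Hamiltonian if and only if $G$ is bipancyclic.
   Context: Graphs are finite, simple and undirected. A bipartite graph is chordal bipartite if every cycle of length at least six has a chord. $P_5$-free means no induced path on five vertices. A graph of order $2n$ is bipancyclic if it contains a cycle of length $2l$ for every $l$ with $2\le l\le n$.
   Formalization: The order 2n is assumed to satisfy n ≥ 2; this excludes only the graph K_2 (n = 1), which is vacuously bipancyclic but has no Hamiltonian cycle, so the claim fails for it. *)

theory Defs
  imports "Graph_Theory.Graph_Theory"
begin

(* A finite simple undirected graph is a pair_graph: every edge {u,v} is represented by the two
   arcs (u,v) and (v,u).  The library counts u,v,u as a cycle of such a symmetric digraph; the
   length bound removes exactly these degenerate cycles. *)
definition undirected_cycle :: "'a pair_pre_digraph \<Rightarrow> ('a \<times> 'a) awalk \<Rightarrow> bool" where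
  "undirected_cycle G p \<longleftrightarrow> pre_digraph.cycle (with_proj G) p \<and> 3 \<le> length p"

definition bipartite_graph :: "'a pair_pre_digraph \<Rightarrow> bool" where
  "bipartite_graph G \<longleftrightarrow>
     (\<exists>X Y. X \<inter> Y = {} \<and> X \<union> Y = pverts G \<and> parcs G \<subseteq> X \<times> Y \<union> Y \<times> X)"

definition has_chord :: "'a pair_pre_digraph \<Rightarrow> ('a \<times> 'a) awalk \<Rightarrow> bool" where
  "has_chord G p \<longleftrightarrow>
     (\<exists>x\<in>fst ` set p. \<exists>y\<in>fst ` set p. (x, y) \<in> parcs G \<and> (x, y) \<notin> set p \<and> (y, x) \<notin> set p)"

definition chordal_bipartite :: "'a pair_pre_digraph \<Rightarrow> bool" where
  "chordal_bipartite G \<longleftrightarrow> bipartite_graph G \<and>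
     (\<forall>p. undirected_cycle G p \<and> 6 \<le> length p \<longrightarrow> has_chord G p)"

definition induced_path :: "'a pair_pre_digraph \<Rightarrow> 'a vwalk \<Rightarrow> bool" where
  "induced_path G vs \<longleftrightarrow> vpath vs (with_proj G) \<and>
     (\<forall>i<length vs. \<forall>j<length vs. (vs ! i, vs ! j) \<in> parcs G \<longrightarrow> j = Suc i \<or> i = Suc j)"

definition P5_free :: "'a pair_pre_digraph \<Rightarrow> bool" where
  "P5_free G \<longleftrightarrow> \<not> (\<exists>vs. induced_path G vs \<and> length vs = 5)"

definition hamiltonian :: "'a pair_pre_digraph \<Rightarrow> bool" where
  "hamiltonian G \<longleftrightarrow> (\<exists>p. undirected_cycle G p \<and> fst ` set p = pverts G)"

(* Vacuously true for graphs of order 2. *)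
definition bipancyclic :: "'a pair_pre_digraph \<Rightarrow> bool" where
  "bipancyclic G \<longleftrightarrow> (\<exists>n. card (pverts G) = 2 * n \<and>
     (\<forall>l. 2 \<le> l \<and> l \<le> n \<longrightarrow> (\<exists>p. undirected_cycle G p \<and> length p = 2 * l)))"

end

(* A cycle of length at least six in a chordal bipartite graph has a chord joining two vertices at
   distance three along the cycle: by parity any chord cuts off a cycle of even length, and as long
   as that length is at least six one can pass to a chord of the smaller cycle. Bypassing the two
   vertices between the ends of such a chord shortens the cycle by two, so a Hamiltonian cycle gives
   rise to cycles of all even lengths. *)
theory Submission
  imports Defs
begin

section \<open>Closed arc walks and vertex lists\<close>

lemma pcas_vwalk_arcs: "vs \<noteq> [] \<Longrightarrow> pcas (hd vs) (vwalk_arcs vs) (last vs)"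
  by (induction vs rule: vwalk_arcs.induct) auto

lemma pawalk_verts_vwalk_arcs: "vs \<noteq> [] \<Longrightarrow> pawalk_verts (hd vs) (vwalk_arcs vs) = vs"
  by (induction vs rule: vwalk_arcs.induct) auto

lemma pawalk_verts_not_Nil: "pawalk_verts u p \<noteq> []"
  by (cases p) auto

lemma hd_pawalk_verts: "pcas u p v \<Longrightarrow> hd (pawalk_verts u p) = u"
  by (cases p) auto

lemma last_pawalk_verts: "pcas u p v \<Longrightarrow> last (pawalk_verts u p) = v"
  by (induction p arbitrary: u) (auto simp: pawalk_verts_not_Nil)

lemma vwalk_arcs_pawalk_verts: "pcas u p v \<Longrightarrow> vwalk_arcs (pawalk_verts u p) = p"
  by (induction p arbitrary: u) (auto simp: pawalk_verts_not_Nil hd_pawalk_verts)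

lemma map_fst_vwalk_arcs: "map fst (vwalk_arcs vs) = butlast vs"
  by (induction vs rule: vwalk_arcs.induct) auto

lemma fst_image_closed_vwalk_arcs: "fst ` set (vwalk_arcs (vs @ [x])) = set vs"
  using map_fst_vwalk_arcs[of "vs @ [x]"] by (metis butlast_snoc image_set)

lemma length_vwalk_arcs: "length (vwalk_arcs vs) = length vs - 1"
  by (induction vs rule: vwalk_arcs.induct) auto

text \<open>The start vertex is not repeated at the end and the closing arc is kept apart, so that
  contiguous pieces of the list are paths and list splitting can replace reasoning about
  walks.\<close>

definition vertex_cycle :: "'a rel \<Rightarrow> 'a list \<Rightarrow> bool" where
  "vertex_cycle E vs \<longleftrightarrow>
     3 \<le> length vs \<and> distinct vs \<and> set (vwalk_arcs vs) \<subseteq> E \<and> (last vs, hd vs) \<in> E"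

lemma undirected_cycle_iff:
  assumes "pair_wf_digraph G"
  shows "undirected_cycle G p \<longleftrightarrow>
    (\<exists>vs. vertex_cycle (parcs G) vs \<and> p = vwalk_arcs (vs @ [hd vs]))"
proof
  interpret pair_wf_digraph G by fact
  assume "undirected_cycle G p"
  then obtain u where p: "3 \<le> length p" "set p \<subseteq> parcs G" "pcas u p u"
      and dist: "distinct (tl (pawalk_verts u p))"
    by (auto simp: undirected_cycle_def cycle_def awalk_def)
  obtain e p' where p': "p = e # p'"
    using p(1) by (cases p) auto
  \<comment> \<open>The vertex list of a closed walk ends by repeating its start \<open>u\<close>;
    this copy is dropped.\<close>
  define vs where "vs = butlast (pawalk_verts u p)"
  have verts: "pawalk_verts u p = vs @ [u]"
    using last_pawalk_verts[OF p(3)] pawalk_verts_not_Nil[of u p]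
    by (metis append_butlast_last_id vs_def)
  have arcs: "vwalk_arcs (vs @ [u]) = p"
    using vwalk_arcs_pawalk_verts[OF p(3)] verts by simp
  have len: "length vs = length p"
    using length_vwalk_arcs[of "vs @ [u]"] arcs by simp
  then have ne: "vs \<noteq> []"
    using p(1) by auto
  have hd: "hd vs = u"
    using hd_pawalk_verts[OF p(3)] verts ne by simp
  \<comment> \<open>Since \<open>vs\<close> starts with \<open>u\<close>, the list
    \<open>tl (vs @ [u])\<close> is a rotation of \<open>vs\<close>.\<close>
  have "distinct vs"
    using dist verts ne hd by (cases vs) auto
  moreover have "set (vwalk_arcs vs) \<subseteq> parcs G" "(last vs, hd vs) \<in> parcs G"
    using p(2) arcs ne hd set_vwalk_arcs_snoc[of vs u] by auto
  ultimately have "vertex_cycle (parcs G) vs"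
    using p(1) len by (simp add: vertex_cycle_def)
  then show "\<exists>vs. vertex_cycle (parcs G) vs \<and> p = vwalk_arcs (vs @ [hd vs])"
    using arcs hd by auto
next
  interpret pair_wf_digraph G by fact
  assume "\<exists>vs. vertex_cycle (parcs G) vs \<and> p = vwalk_arcs (vs @ [hd vs])"
  then obtain vs where vs: "3 \<le> length vs" "distinct vs" "set (vwalk_arcs vs) \<subseteq> parcs G"
      "(last vs, hd vs) \<in> parcs G" and p: "p = vwalk_arcs (vs @ [hd vs])"
    by (auto simp: vertex_cycle_def)
  have ne: "vs \<noteq> []"
    using vs(1) by auto
  have "set p \<subseteq> parcs G"
    using vs ne by (simp add: p set_vwalk_arcs_snoc)
  moreover have "pcas (hd vs) p (hd vs)"
    using pcas_vwalk_arcs[of "vs @ [hd vs]"] ne by (simp add: p)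
  moreover have "pawalk_verts (hd vs) p = vs @ [hd vs]"
    using pawalk_verts_vwalk_arcs[of "vs @ [hd vs]"] ne by (simp add: p)
  moreover have "length p = length vs"
    by (simp add: p length_vwalk_arcs)
  moreover have "hd vs \<in> pverts G"
    using vs(4) by (rule in_arcsD2)
  moreover have "distinct (tl (vs @ [hd vs]))"
    using vs(2) ne by (cases vs) auto
  ultimately show "undirected_cycle G p"
    using vs(1) by (auto simp: undirected_cycle_def cycle_def awalk_def intro!: exI[of _ "hd vs"])
qed

section \<open>Parity and chords of cycles in bipartite graphs\<close>

lemma bipartite_walk_parity:
  assumes "X \<inter> Y = {}" "E \<subseteq> X \<times> Y \<union> Y \<times> X"
    and "vs \<noteq> []" "set (vwalk_arcs vs) \<subseteq> E"
  shows "(hd vs \<in> X \<longleftrightarrow> last vs \<in> X) \<longleftrightarrow> odd (length vs)"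
  using assms(3,4)
proof (induction vs rule: vwalk_arcs.induct)
  case (3 x y zs)
  then have "(x, y) \<in> E"
    by simp
  \<comment> \<open>Every arc switches sides. As \<open>length\<close> counts vertices, one more
    than arcs, the ends lie on the same side exactly when the length is odd.\<close>
  then have "x \<in> X \<longleftrightarrow> y \<notin> X"
    using assms(1,2) by blast
  with 3 show ?case
    by auto
qed auto

lemma bipartite_edge_closes_even_walk:
  assumes "X \<inter> Y = {}" "E \<subseteq> X \<times> Y \<union> Y \<times> X"
    and "vs \<noteq> []" "set (vwalk_arcs vs) \<subseteq> E" "(last vs, hd vs) \<in> E"
  shows "even (length vs)"
proof -
  have "last vs \<in> X \<longleftrightarrow> hd vs \<notin> X"
    using assms(1,2,5) by blast
  then show ?thesis
    using bipartite_walk_parity[OF assms(1-4)] by blast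
qed

text \<open>A chord is an edge that the cycle does not use. The condition on \<open>bs\<close>
  expresses this for the arcs inside the list, and the disjunction on \<open>as\<close> and
  \<open>cs\<close> for the closing arc; the latter also makes the piece from \<open>x\<close> to
  \<open>y\<close> shorter than \<open>vs\<close>.\<close>

lemma has_chord_split:
  assumes "sym (parcs G)" "has_chord G (vwalk_arcs (vs @ [hd vs]))" "vs \<noteq> []"
    and no_loops: "\<And>x. (x, x) \<notin> parcs G"
  obtains as x bs y cs where "vs = as @ x # bs @ y # cs" "(x, y) \<in> parcs G"
    "bs \<noteq> []" "as \<noteq> [] \<or> cs \<noteq> []"
proof -
  let ?p = "vwalk_arcs (vs @ [hd vs])"
  obtain u v where uv: "u \<in> set vs" "v \<in> set vs" "(u, v) \<in> parcs G"
      "(u, v) \<notin> set ?p" "(v, u) \<notin> set ?p"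
    using assms(2) by (auto simp: has_chord_def fst_image_closed_vwalk_arcs)
  have "u \<noteq> v"
    using uv(3) no_loops by auto
  obtain ps qs where pq: "vs = ps @ u # qs"
    using uv(1) by (meson split_list)
  \<comment> \<open>The ends of the chord are renamed by their order in \<open>vs\<close>; symmetry
    of the edge relation makes this harmless.\<close>
  have "\<exists>as x bs y cs. vs = as @ x # bs @ y # cs \<and> {x, y} = {u, v}"
  proof (cases "v \<in> set qs")
    case True
    then show ?thesis
      using pq by (metis split_list)
  next
    case False
    then have "v \<in> set ps"
      using uv(2) pq \<open>u \<noteq> v\<close> by auto
    then obtain as bs where "ps = as @ v # bs"
      by (meson split_list)
    then have "vs = as @ v # bs @ u # qs"
      using pq by simp
    then show ?thesis
      by (metis insert_commute)
  qed
  then obtain as x bs y cs where split: "vs = as @ x # bs @ y # cs" and xy: "{x, y} = {u, v}"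
    by blast
  have edge: "(x, y) \<in> parcs G"
    using uv(3) xy assms(1) by (auto simp: doubleton_eq_iff dest: symD)
  have no_arc: "(x, y) \<notin> set ?p" "(y, x) \<notin> set ?p"
    using uv(4,5) xy by (auto simp: doubleton_eq_iff)
  have "bs \<noteq> []"
  proof
    assume "bs = []"
    then have "vs @ [hd vs] = (as @ [x]) @ (y # cs @ [hd vs])"
      using split by simp
    then have "?p = vwalk_arcs (as @ [x]) @ (x, y) # vwalk_arcs (y # cs @ [hd vs])"
      using vwalk_arcs_append[of "as @ [x]" "y # cs @ [hd vs]"] by simp
    then have "(x, y) \<in> set ?p"
      by simp
    then show False
      using no_arc(1) by simp
  qed
  moreover have "as \<noteq> [] \<or> cs \<noteq> []"
  proof (rule ccontr)
    assume "\<not> (as \<noteq> [] \<or> cs \<noteq> [])"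
    then have "last vs = y" "hd vs = x"
      using split by auto
    then have "(y, x) \<in> set ?p"
      using assms(3) by (simp add: set_vwalk_arcs_snoc)
    then show False
      using no_arc(2) by simp
  qed
  ultimately show thesis
    using that split edge by blast
qed

text \<open>Strong induction on the length. The piece between the ends of a chord is contiguous in
  \<open>vs\<close>, so four consecutive entries of it are also consecutive in \<open>vs\<close>,
  and the cycle never has to be rotated.\<close>

lemma chordal_bipartite_short_chord:
  assumes "pair_graph G" "chordal_bipartite G"
    and "vertex_cycle (parcs G) vs" "6 \<le> length vs"
  shows "\<exists>as a b c d cs. vs = as @ [a, b, c, d] @ cs \<and> (a, d) \<in> parcs G"
  using assms(3,4)
proof (induction "length vs" arbitrary: vs rule: less_induct)
  case less
  interpret pair_graph G by fact
  have sym: "sym (parcs G)"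
    using arcs_symmetric by (auto intro: symI)
  have no_loop: "(x, x) \<notin> parcs G" for x
    using pair_no_loops by force
  obtain X Y where XY: "X \<inter> Y = {}" "parcs G \<subseteq> X \<times> Y \<union> Y \<times> X"
    using assms(2) by (auto simp: chordal_bipartite_def bipartite_graph_def)
  have "undirected_cycle G (vwalk_arcs (vs @ [hd vs]))"
    using less.prems(1) undirected_cycle_iff[OF pair_wf_digraph] by blast
  moreover have "length (vwalk_arcs (vs @ [hd vs])) = length vs"
    by (simp add: length_vwalk_arcs)
  ultimately have "has_chord G (vwalk_arcs (vs @ [hd vs]))"
    using assms(2) less.prems(2) by (simp add: chordal_bipartite_def)
  moreover have "vs \<noteq> []"
    using less.prems(2) by auto
  ultimately obtain as x bs y cs where vs: "vs = as @ x # bs @ y # cs"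
      and xy: "(x, y) \<in> parcs G" and ne: "bs \<noteq> []" "as \<noteq> [] \<or> cs \<noteq> []"
    using sym no_loop has_chord_split[of G vs] by metis
  let ?ws = "x # bs @ [y]"
  have vs': "vs = as @ ?ws @ cs"
    using vs by simp
  have arcs: "set (vwalk_arcs ?ws) \<subseteq> parcs G"
    using less.prems(1) set_vwalk_arcs_append1[of ?ws cs] set_vwalk_arcs_append2[of "?ws @ cs" as]
    unfolding vertex_cycle_def vs' by blast
  have yx: "(y, x) \<in> parcs G"
    using xy by (rule arcs_symmetric)
  \<comment> \<open>The chord, read from \<open>y\<close> to \<open>x\<close>, closes the piece to a
    cycle.\<close>
  have "even (length ?ws)"
    using bipartite_edge_closes_even_walk[OF XY, of ?ws] arcs yx by simp
  then have even: "even (length bs)"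
    by simp
  show ?case
  proof (cases "length bs = 2")
    case True
    then obtain b c where "bs = [b, c]"
      by (auto simp: length_Suc_conv numeral_2_eq_2)
    then have "vs = as @ [x, b, c, y] @ cs"
      using vs by simp
    then show ?thesis
      using xy by blast
  next
    case False
    \<comment> \<open>The length of \<open>bs\<close> is even, positive and not 2, hence at least
      4.\<close>
    then have len: "6 \<le> length ?ws"
      using even ne(1) by (cases "length bs"; cases "length bs - 1"; auto elim!: evenE)
    moreover have "length ?ws < length vs"
      using vs ne(2) by auto
    moreover have "vertex_cycle (parcs G) ?ws"
      using less.prems(1) arcs yx len by (auto simp: vertex_cycle_def vs)
    ultimately obtain as' a b c d cs' where "?ws = as' @ [a, b, c, d] @ cs'" "(a, d) \<in> parcs G"
      using less.hyps[of ?ws] by blast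
    then have "vs = (as @ as') @ [a, b, c, d] @ (cs' @ cs)"
      using vs' by simp
    then show ?thesis
      using \<open>(a, d) \<in> parcs G\<close> by blast
  qed
qed

section \<open>Cycles of all smaller even lengths\<close>

lemma chordal_bipartite_shorten_cycle:
  assumes "pair_graph G" "chordal_bipartite G"
    and "vertex_cycle (parcs G) vs" "6 \<le> length vs"
  shows "\<exists>ws. vertex_cycle (parcs G) ws \<and> length ws = length vs - 2"
proof -
  obtain as a b c d cs where vs: "vs = as @ [a, b, c, d] @ cs" and ad: "(a, d) \<in> parcs G"
    using chordal_bipartite_short_chord[OF assms] by blast
  let ?l = "as @ [a]" and ?r = "d # cs"
  have vs': "vs = ?l @ [b, c] @ ?r"
    using vs by simp
  have "set (vwalk_arcs vs) \<subseteq> parcs G"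
    using assms(3) by (simp add: vertex_cycle_def)
  then have "set (vwalk_arcs ?l) \<subseteq> parcs G" "set (vwalk_arcs ?r) \<subseteq> parcs G"
    using set_vwalk_arcs_append1[of ?l "[b, c] @ ?r"] set_vwalk_arcs_append2[of ?r "?l @ [b, c]"]
    unfolding vs' append_assoc by blast+
  then have "set (vwalk_arcs (?l @ ?r)) \<subseteq> parcs G"
    using ad by (simp add: vwalk_arcs_append del: append_assoc)
  \<comment> \<open>Only \<open>b\<close> and \<open>c\<close> disappear, and neither is an end of
    the list, so the old closing arc still closes the new cycle.\<close>
  moreover have "hd (?l @ ?r) = hd vs" "last (?l @ ?r) = last vs"
    using vs by (cases as; simp)+
  ultimately have "vertex_cycle (parcs G) (?l @ ?r)"
    using assms(3,4) by (auto simp: vertex_cycle_def vs)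
  moreover have "length (?l @ ?r) = length vs - 2"
    using vs by simp
  ultimately show ?thesis
    by blast
qed

text \<open>Induction downwards from \<open>n\<close>. The bound \<open>2 \<le> l\<close> stays a
  premise because it guarantees that the cycle of length \<open>2 * Suc l\<close> is long enough to
  be shortened.\<close>

lemma chordal_bipartite_shorter_even_cycles:
  assumes "pair_graph G" "chordal_bipartite G"
    and "vertex_cycle (parcs G) vs" "length vs = 2 * n" "2 \<le> l" "l \<le> n"
  shows "\<exists>ws. vertex_cycle (parcs G) ws \<and> length ws = 2 * l"
  using assms(6,5)
proof (induction l rule: inc_induct)
  case base
  then show ?case
    using assms(3,4) by blast
next
  case (step l)
  then obtain ws where "vertex_cycle (parcs G) ws" "length ws = 2 * Suc l"
    by auto
  then show ?case
    using chordal_bipartite_shorten_cycle[OF assms(1,2), of ws] step.prems by auto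
qed

theorem theorem7:
  fixes G :: "'a pair_pre_digraph" and n :: nat
  assumes "pair_graph G"
    and "Digraph_Component.connected (with_proj G)"
    and "P5_free G"
    and "chordal_bipartite G"
    and "card (pverts G) = 2 * n"
    and "2 \<le> n"
  shows "hamiltonian G \<longleftrightarrow> bipancyclic G"
proof
  interpret pair_graph G by fact
  note cycle_iff = undirected_cycle_iff[OF pair_wf_digraph]
  {
    assume "hamiltonian G"
    then obtain vs where vs: "vertex_cycle (parcs G) vs" "set vs = pverts G"
      using cycle_iff by (auto simp: hamiltonian_def fst_image_closed_vwalk_arcs)
    then have "length vs = 2 * n"
      using assms(5) distinct_card[of vs] by (simp add: vertex_cycle_def)
    then have "\<exists>p. undirected_cycle G p \<and> length p = 2 * l" if "2 \<le> l" "l \<le> n" for l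
      using chordal_bipartite_shorter_even_cycles[OF assms(1,4) vs(1) _ that] cycle_iff
      by (metis add_diff_cancel_right' length_append_singleton length_vwalk_arcs Suc_eq_plus1)
    then show "bipancyclic G"
      using assms(5) by (auto simp: bipancyclic_def)
  next
    assume "bipancyclic G"
    then obtain p where p: "undirected_cycle G p" "length p = 2 * n"
      using assms(5,6) by (auto simp: bipancyclic_def)
    then obtain vs where vs: "vertex_cycle (parcs G) vs" "p = vwalk_arcs (vs @ [hd vs])"
      using cycle_iff by blast
    have "fst ` set p \<subseteq> pverts G"
      using p(1) arc_fst_in_verts by (fastforce simp: undirected_cycle_def cycle_def awalk_def)
    moreover have "card (set vs) = 2 * n"
      using vs p(2) distinct_card[of vs] by (simp add: vertex_cycle_def length_vwalk_arcs)
    \<comment> \<open>A cycle with \<open>2 * n\<close> distinct vertices exhausts a vertex set of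
      that size.\<close>
    ultimately have "fst ` set p = pverts G"
      using assms(5) fst_image_closed_vwalk_arcs[of vs "hd vs"] vs(2) card_subset_eq[OF pair_finite_verts] by metis
    then show "hamiltonian G"
      using p(1) by (auto simp: hamiltonian_def)
  }
qed

end
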